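(* Let $k$ be a field. The Hilbert--Poincaré series of $\Pi(G_2)$ with respect to path length is $$h_{\Pi(G_2)}(t)=4+6t+8t^2+6t^3+4t^4,$$ where the coefficient of $t^i$ is the dimension of the subspace $\Pi^i(G_2)$ spanned by length $i$ paths. Using the bigrading $(t,s)$ by path length and $x$-degree, the matrix-valued Hilbert--Poincaré series, whose $(i,j)$ entry is $h_{e_i\Pi(G_2)e_j}(t,s)$, is $$(1+t^2s)\left(\begin{array}{cc}1+t^2s^2&(1+s+s^2)t\\(1+s+s^2)t&(1+s+s^2)(1+t^2)\end{array}\right).$$
   Context: Definition of $\Pi(G_2)$. It is the decorated preprojective algebra of the quiver $1\to2$ decorated by $k$ at vertex $1$, by $S=k[x]/(x^3)$ at vertex $2$ and by ${}_kS_S$ on the arrow (signs dropped): $$\Pi(G_2)=T_{S\oplus k}({}_kS_S\oplus{}_SS_k)/\langle{}_k1\otimes_S1_k+1\otimes_kx^2+x\otimes_kx+x^2\otimes_k1\rangle.$$ Explicitly, it is the $k$-algebra generated by orthogonal idempotents $e_1,e_2$ with $e_1+e_2=1$, and $a\in e_1(\cdot)e_2$, $b\in e_2(\cdot)e_1$, $x\in e_2(\cdot)e_2$ (products read left to right), with relations $x^3=0$, $ab=0$, $bax^2+xbax+x^2ba=0$; here $a$ is the generator ${}_k1_S$ of ${}_kS_S$ and $b$ is the generator ${}_S1_k$ of ${}_SS_k$. Gradings. Path length: $a,b$ have length $1$, $e_1,e_2,x$ have length $0$. $x$-degree: $x$ has degree $1$, and $e_1,e_2,a,b$ have degree $0$.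 *)

theory Defs
  imports
    "HOL-Library.Poly_Mapping"
    "HOL-Computational_Algebra.Formal_Power_Series"
    "Jordan_Normal_Form.Matrix"
begin

section \<open>The free algebra on the generators of \<open>\<Pi>(G\<^sub>2)\<close>\<close>

datatype generator = GE1 | GE2 | GA | GB | GX

text \<open>The free monoid is written additively, as \<^typ>\<open>'a \<Rightarrow>\<^sub>0 'b\<close> carries the convolution product
  only for exponents in \<^class>\<open>monoid_add\<close>; hence \<open>generator gword \<Rightarrow>\<^sub>0 'k\<close> is the free unital
  associative \<open>'k\<close>-algebra on \<^typ>\<open>generator\<close>.\<close>

datatype 'g gword = Word (letters: "'g list")

instantiation gword :: (type) monoid_add
begin

definition zero_gword :: "'a gword" where
  "0 = Word []"

definition plus_gword :: "'a gword \<Rightarrow> 'a gword \<Rightarrow> 'a gword" where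
  "v + w = Word (letters v @ letters w)"

instance
  by standard (simp_all add: zero_gword_def plus_gword_def)

end

type_synonym ('g, 'k) free_algebra = "'g gword \<Rightarrow>\<^sub>0 'k"

definition word :: "'g list \<Rightarrow> ('g, 'k::field) free_algebra" where
  "word gs = Poly_Mapping.single (Word gs) 1"

definition scalar :: "'k \<Rightarrow> ('g, 'k::field) free_algebra" where
  "scalar c = Poly_Mapping.single 0 c"

lemma scalar_add: "scalar (c + d) = scalar c + scalar d"
  by (simp add: scalar_def single_add)

lemma scalar_mult: "scalar (c * d) = scalar c * scalar d"
  by (simp add: scalar_def mult_single)

lemma scalar_1: "scalar 1 = 1"
  by (simp add: scalar_def)

lemma scalar_central: "scalar c * p = p * scalar c"
proof (induction p rule: update_induct)
  case const
  then show ?case by simp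
next
  case (update p w d)
  have "Poly_Mapping.update w d p = p + Poly_Mapping.single w d"
    using update by (intro poly_mapping_eqI)
      (auto simp: lookup_update lookup_add lookup_single when_def in_keys_iff)
  with update show ?case
    by (simp add: scalar_def mult_single algebra_simps)
qed

inductive_set two_sided_ideal :: "('a::ring_1) set \<Rightarrow> 'a set" for R where
  zero: "0 \<in> two_sided_ideal R"
| gen: "r \<in> R \<Longrightarrow> p * r * q \<in> two_sided_ideal R"
| add: "p \<in> two_sided_ideal R \<Longrightarrow> q \<in> two_sided_ideal R \<Longrightarrow> p + q \<in> two_sided_ideal R"

lemma two_sided_ideal_mult_left:
  "p \<in> two_sided_ideal R \<Longrightarrow> q * p \<in> two_sided_ideal R"
proof (induction rule: two_sided_ideal.induct)
  case (gen r p p')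
  then show ?case
    using two_sided_ideal.gen[of r R "q * p" p'] by (simp add: mult.assoc)
qed (simp_all add: two_sided_ideal.intros distrib_left)

lemma two_sided_ideal_mult_right:
  "p \<in> two_sided_ideal R \<Longrightarrow> p * q \<in> two_sided_ideal R"
proof (induction rule: two_sided_ideal.induct)
  case (gen r p p')
  then show ?case
    using two_sided_ideal.gen[of r R p "p' * q"] by (simp add: mult.assoc)
qed (simp_all add: two_sided_ideal.intros distrib_right)

lemma two_sided_ideal_uminus:
  "p \<in> two_sided_ideal R \<Longrightarrow> - p \<in> two_sided_ideal R"
  using two_sided_ideal_mult_left[of p R "- 1"] by simp

section \<open>The algebra \<open>\<Pi>(G\<^sub>2)\<close>\<close>

text \<open>Products are read from left to right. The first eight relations say that \<open>e\<^sub>1, e\<^sub>2\<close> are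
  orthogonal idempotents with sum \<open>1\<close> and that \<open>a \<in> e\<^sub>1 \<Pi> e\<^sub>2\<close>, \<open>b \<in> e\<^sub>2 \<Pi> e\<^sub>1\<close>, \<open>x \<in> e\<^sub>2 \<Pi> e\<^sub>2\<close>
  (for idempotents \<open>e, f\<close>, \<open>u \<in> e \<Pi> f\<close> iff \<open>e u f = u\<close>). The components of the preprojective relation
  at the vertices 1 and 2 are the last two.\<close>

definition G2_relations :: "(generator, 'k::field) free_algebra set" where
  "G2_relations =
     {word [GE1, GE1] - word [GE1], word [GE2, GE2] - word [GE2],
      word [GE1, GE2], word [GE2, GE1], word [GE1] + word [GE2] - 1,
      word [GE1, GA, GE2] - word [GA], word [GE2, GB, GE1] - word [GB], word [GE2, GX, GE2] - word [GX],
      word [GX, GX, GX],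
      word [GA, GB],
      word [GB, GA, GX, GX] + word [GX, GB, GA, GX] + word [GX, GX, GB, GA]}"

definition G2_cong :: "(generator, 'k::field) free_algebra \<Rightarrow> (generator, 'k) free_algebra \<Rightarrow> bool" where
  "G2_cong p q \<longleftrightarrow> p - q \<in> two_sided_ideal G2_relations"

lemma equivp_G2_cong: "equivp G2_cong"
proof (rule equivpI)
  show "reflp G2_cong"
    by (simp add: reflp_def G2_cong_def two_sided_ideal.zero)
  show "symp G2_cong"
    unfolding symp_def G2_cong_def using two_sided_ideal_uminus by force
  show "transp G2_cong"
    unfolding transp_def G2_cong_def using two_sided_ideal.add by fastforce
qed

quotient_type (overloaded) 'k Pi_G2 = "(generator, 'k::field) free_algebra" / G2_cong
  by (rule equivp_G2_cong)

instantiation Pi_G2 :: (field) ring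
begin

lift_definition zero_Pi_G2 :: "'a Pi_G2" is 0 .

lift_definition plus_Pi_G2 :: "'a Pi_G2 \<Rightarrow> 'a Pi_G2 \<Rightarrow> 'a Pi_G2" is "(+)"
  unfolding G2_cong_def by (metis add_diff_add two_sided_ideal.add)

lift_definition uminus_Pi_G2 :: "'a Pi_G2 \<Rightarrow> 'a Pi_G2" is uminus
  unfolding G2_cong_def by (metis minus_diff_minus two_sided_ideal_uminus)

lift_definition minus_Pi_G2 :: "'a Pi_G2 \<Rightarrow> 'a Pi_G2 \<Rightarrow> 'a Pi_G2" is "(-)"
proof -
  fix p p' q q' :: "(generator, 'a) free_algebra"
  assume "G2_cong p p'" "G2_cong q q'"
  moreover have "p - q - (p' - q') = (p - p') + - (q - q')"
    by simp
  ultimately show "G2_cong (p - q) (p' - q')"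
    unfolding G2_cong_def by (metis two_sided_ideal.add two_sided_ideal_uminus)
qed

lift_definition times_Pi_G2 :: "'a Pi_G2 \<Rightarrow> 'a Pi_G2 \<Rightarrow> 'a Pi_G2" is "(*)"
proof -
  fix p p' q q' :: "(generator, 'a) free_algebra"
  assume "G2_cong p p'" "G2_cong q q'"
  moreover have "p * q - p' * q' = (p - p') * q + p' * (q - q')"
    by (simp add: algebra_simps)
  ultimately show "G2_cong (p * q) (p' * q')"
    unfolding G2_cong_def
    by (metis two_sided_ideal.add two_sided_ideal_mult_left two_sided_ideal_mult_right)
qed

instance
  by standard (transfer, simp add: G2_cong_def two_sided_ideal.zero algebra_simps)+

end

instantiation Pi_G2 :: (field) monoid_mult
begin

lift_definition one_Pi_G2 :: "'a Pi_G2" is 1 .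

instance
  by standard (transfer, simp add: G2_cong_def two_sided_ideal.zero)+

end

lift_definition scale_Pi_G2 :: "'k \<Rightarrow> 'k::field Pi_G2 \<Rightarrow> 'k Pi_G2" is "\<lambda>c p. scalar c * p"
  unfolding G2_cong_def by (metis right_diff_distrib two_sided_ideal_mult_left)

global_interpretation Pi_G2: vector_space scale_Pi_G2
proof
  fix c d :: "'k::field" and u v :: "'k Pi_G2"
  show "scale_Pi_G2 c (u + v) = scale_Pi_G2 c u + scale_Pi_G2 c v"
    by transfer (simp add: G2_cong_def two_sided_ideal.zero algebra_simps)
  show "scale_Pi_G2 (c + d) u = scale_Pi_G2 c u + scale_Pi_G2 d u"
    by transfer (simp add: G2_cong_def two_sided_ideal.zero algebra_simps scalar_add)
  show "scale_Pi_G2 c (scale_Pi_G2 d u) = scale_Pi_G2 (c * d) u"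
    by transfer (simp add: G2_cong_def two_sided_ideal.zero scalar_mult mult.assoc)
  show "scale_Pi_G2 1 u = u"
    by transfer (simp add: G2_cong_def two_sided_ideal.zero scalar_1)
qed

lemma scale_Pi_G2_mult_left: "scale_Pi_G2 c u * v = scale_Pi_G2 c (u * v)"
  by transfer (simp add: G2_cong_def two_sided_ideal.zero mult.assoc)

lemma scale_Pi_G2_mult_right: "u * scale_Pi_G2 c v = scale_Pi_G2 c (u * v)"
proof transfer
  fix p q :: "(generator, 'k::field) free_algebra" and c :: 'k
  have "p * (scalar c * q) = scalar c * (p * q)"
    by (metis scalar_central mult.assoc)
  then show "G2_cong (p * (scalar c * q)) (scalar c * (p * q))"
    by (simp add: G2_cong_def two_sided_ideal.zero)
qed

section \<open>Gradings and Hilbert--Poincare series\<close>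

text \<open>Words that are not paths in the quiver (such as \<open>a\<^sup>2\<close>) have class \<open>0\<close>, and idempotents inside
  a path can be dropped, so spans of classes of all words of a given degree are spanned by paths.\<close>

lift_definition G2_path :: "generator list \<Rightarrow> 'k::field Pi_G2" is word .

definition path_length :: "generator list \<Rightarrow> nat" where
  "path_length gs = count_list gs GA + count_list gs GB"

definition x_degree :: "generator list \<Rightarrow> nat" where
  "x_degree gs = count_list gs GX"

definition Pi_len :: "nat \<Rightarrow> 'k::field Pi_G2 set" where
  "Pi_len n = Pi_G2.span {G2_path gs |gs. path_length gs = n}"

definition Pi_bideg :: "nat \<Rightarrow> nat \<Rightarrow> 'k::field Pi_G2 set" where
  "Pi_bideg n d = Pi_G2.span {G2_path gs |gs. path_length gs = n \<and> x_degree gs = d}"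

abbreviation e1 :: "'k::field Pi_G2" where "e1 \<equiv> G2_path [GE1]"
abbreviation e2 :: "'k::field Pi_G2" where "e2 \<equiv> G2_path [GE2]"

definition corner_bideg :: "'k::field Pi_G2 \<Rightarrow> 'k Pi_G2 \<Rightarrow> nat \<Rightarrow> nat \<Rightarrow> 'k Pi_G2 set" where
  "corner_bideg e f n d = {e * u * f |u. u \<in> Pi_bideg n d}"

text \<open>The library's \<open>dim\<close> is \<open>0\<close> on infinite-dimensional spaces, so statements about the series below
  have to be accompanied by finite-dimensionality of the components.\<close>

definition Pi_fin_dim :: "'k::field Pi_G2 set \<Rightarrow> bool" where
  "Pi_fin_dim V \<longleftrightarrow> (\<exists>S. finite S \<and> V \<subseteq> Pi_G2.span S)"

definition hilbert_series :: "(nat \<Rightarrow> 'k::field Pi_G2 set) \<Rightarrow> int fps" where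
  "hilbert_series V = Abs_fps (\<lambda>n. int (Pi_G2.dim (V n)))"

text \<open>In \<^typ>\<open>int fps fps\<close> the outer variable is \<open>t\<close> (path length) and the inner one is \<open>s\<close>
  (\<open>x\<close>-degree).\<close>

definition hilbert_series2 :: "(nat \<Rightarrow> nat \<Rightarrow> 'k::field Pi_G2 set) \<Rightarrow> int fps fps" where
  "hilbert_series2 V = Abs_fps (\<lambda>n. hilbert_series (V n))"

end

theory Submission
  imports Defs
begin

text \<open>
  Left multiplication of the last relation by \<open>a\<close> gives \<open>axbax = - ax\<^sup>2ba\<close>, and \<open>ax\<^sup>2baxba = 0\<close> is a further
  consequence. With \<open>bax\<^sup>2\<close> rewritten to \<open>- xbax - x\<^sup>2ba\<close>, these rules reduce every path to a
  combination of 28 normal words; all the rules are homogeneous in both gradings. The right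
  multiplication table on the normal words defines a right module over the free algebra that
  satisfies all the relations, hence over \<open>\<Pi>(G\<^sub>2)\<close>. Acting on the image of \<open>1\<close>, a normal word gives its own
  basis vector, so the normal words are linearly independent. The series are then read off the list.
\<close>

section \<open>Modules over free algebras\<close>

definition linear_endo :: "(('i \<Rightarrow> 'k::field) \<Rightarrow> 'i \<Rightarrow> 'k) \<Rightarrow> bool" where
  "linear_endo F \<longleftrightarrow> (\<forall>u v. F (\<lambda>i. u i + v i) = (\<lambda>i. F u i + F v i))
    \<and> (\<forall>c v. F (\<lambda>i. c * v i) = (\<lambda>i. c * F v i))"

lemma linear_endo_add: "linear_endo F \<Longrightarrow> F (\<lambda>i. u i + v i) i = F u i + F v i"
  and linear_endo_scale: "linear_endo F \<Longrightarrow> F (\<lambda>i. c * v i) i = c * F v i"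
  by (simp_all add: linear_endo_def)

lemma linear_endo_zero: "linear_endo F \<Longrightarrow> F (\<lambda>i. 0) = (\<lambda>i. 0)"
  unfolding linear_endo_def by (drule conjunct2, drule spec[of _ 0]) simp

lemma linear_endo_comp:
  assumes "linear_endo F" "linear_endo G"
  shows "linear_endo (\<lambda>v. G (F v))"
  using assms unfolding linear_endo_def by presburger

lemma linear_endo_fold:
  assumes "\<And>g. linear_endo (f g)"
  shows "linear_endo (fold f gs)"
proof (induction gs)
  case Nil
  then show ?case by (simp add: linear_endo_def)
next
  case (Cons g gs)
  from linear_endo_comp[OF assms[of g] Cons] show ?case by (simp add: comp_def)
qed

text \<open>\<open>fold\<close> lets the leftmost letter act first, so this is a right action, in
  line with products read from left to right.\<close>

definition free_act ::
  "('g \<Rightarrow> ('i \<Rightarrow> 'k) \<Rightarrow> 'i \<Rightarrow> 'k) \<Rightarrow> ('g, 'k::field) free_algebra \<Rightarrow> ('i \<Rightarrow> 'k) \<Rightarrow> 'i \<Rightarrow> 'k" where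
  "free_act f p v i = (\<Sum>w\<in>Poly_Mapping.keys p. Poly_Mapping.lookup p w * fold f (letters w) v i)"

text \<open>Lets the sums for \<open>p\<close>, \<open>q\<close> and \<open>p + q\<close> run over
  one index set.\<close>

lemma free_act_superset:
  assumes "finite A" "Poly_Mapping.keys p \<subseteq> A"
  shows "free_act f p v i = (\<Sum>w\<in>A. Poly_Mapping.lookup p w * fold f (letters w) v i)"
  unfolding free_act_def using assms
  by (intro sum.mono_neutral_left) (auto simp: in_keys_iff)

lemma free_act_0 [simp]: "free_act f 0 v i = 0"
  by (simp add: free_act_def)

lemma free_act_single [simp]:
  "free_act f (Poly_Mapping.single w c) v i = c * fold f (letters w) v i"
  by (subst free_act_superset[of "{w}"]) auto

lemma free_act_word [simp]: "free_act f (word gs) v = fold f gs v"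
  by (simp add: word_def fun_eq_iff)

lemma free_act_1 [simp]: "free_act f 1 v = v"
  by (simp add: fun_eq_iff zero_gword_def flip: single_one)

lemma free_act_add [simp]: "free_act f (p + q) v i = free_act f p v i + free_act f q v i"
proof -
  let ?A = "Poly_Mapping.keys p \<union> Poly_Mapping.keys q"
  have "Poly_Mapping.keys (p + q) \<subseteq> ?A" by (rule keys_add)
  then show ?thesis
    by (simp add: free_act_superset[of ?A] lookup_add distrib_right sum.distrib)
qed

lemma free_act_uminus [simp]: "free_act f (- p) v i = - free_act f p v i"
  using free_act_add[of f p "- p" v i] by (simp add: eq_neg_iff_add_eq_0 add.commute)

lemma free_act_diff [simp]: "free_act f (p - q) v i = free_act f p v i - free_act f q v i"
  using free_act_add[of f p "- q" v i] by simp

lemma linear_endo_free_act: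
  assumes "\<And>g. linear_endo (f g)"
  shows "linear_endo (free_act f p)"
  using linear_endo_fold[of f, OF assms]
  by (simp add: linear_endo_def free_act_def fun_eq_iff distrib_left sum.distrib sum_distrib_left
      mult.left_commute)

lemma free_algebra_induct [case_names zero single add]:
  assumes "P 0" "\<And>w c. P (Poly_Mapping.single w c)" "\<And>p q. P p \<Longrightarrow> P q \<Longrightarrow> P (p + q)"
  shows "P (p :: ('g, 'k::field) free_algebra)"
proof (induction p rule: update_induct)
  case const
  show ?case by (rule assms(1))
next
  case (update p w d)
  have "Poly_Mapping.update w d p = p + Poly_Mapping.single w d"
    using update by (intro poly_mapping_eqI)
      (auto simp: lookup_update lookup_add lookup_single when_def in_keys_iff)
  with update assms show ?case by simp
qed

text \<open>Both sides are additive in \<open>p\<close> and in \<open>q\<close>, so monomials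
  suffice; there, \<open>fold\<close> over a concatenation acts with the first word and then with
  the second.\<close>

lemma free_act_mult:
  assumes "\<And>g. linear_endo (f g)"
  shows "free_act f (p * q) v = free_act f q (free_act f p v)"
proof (induction p rule: free_algebra_induct)
  case zero
  then show ?case
    using linear_endo_zero[OF linear_endo_free_act[OF assms]] by (simp add: fun_eq_iff free_act_def)
next
  case (add p p')
  have "free_act f (p + p') v = (\<lambda>i. free_act f p v i + free_act f p' v i)"
    by (rule ext) simp
  moreover have "free_act f q (\<lambda>i. free_act f p v i + free_act f p' v i)
      = (\<lambda>i. free_act f q (free_act f p v) i + free_act f q (free_act f p' v) i)"
    by (rule ext) (rule linear_endo_add[OF linear_endo_free_act[of f, OF assms]])
  ultimately show ?case
    using add by (simp add: fun_eq_iff distrib_right)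
next
  case (single w c)
  show ?case
  proof (induction q rule: free_algebra_induct)
    case (single w' c')
    show ?case
      using linear_endo_scale[OF linear_endo_fold[of f, OF assms]]
      by (simp add: fun_eq_iff mult_single plus_gword_def mult.commute mult.left_commute)
  qed (simp_all add: fun_eq_iff distrib_left)
qed

text \<open>This makes the action descend to a quotient. In \<open>p * r * q\<close> the factor
  \<open>p\<close> moves \<open>v\<close> to another vector before \<open>r\<close> acts, hence the
  hypothesis on \<open>R\<close> for all \<open>v\<close>.\<close>

lemma free_act_ideal:
  assumes "\<And>g. linear_endo (f g)"
    and "\<And>r v. r \<in> R \<Longrightarrow> free_act f r v = (\<lambda>i. 0)"
    and "p \<in> two_sided_ideal R"
  shows "free_act f p v = (\<lambda>i. 0)"
  using assms(3)
proof (induction arbitrary: v)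
  case zero
  then show ?case by (simp add: fun_eq_iff)
next
  case (gen r p q)
  then show ?case
    by (simp add: free_act_mult assms linear_endo_zero linear_endo_free_act)
next
  case (add p q)
  then show ?case by (simp add: fun_eq_iff)
qed

section \<open>The spanning set of normal words\<close>

text \<open>The lists are split by corner; \<open>basis12\<close> holds the words from vertex 1 to
  vertex 2. The words starting at vertex 2 are the products of \<open>1, x, x^2\<close> with
  \<open>e2, b, ba, bax, baxb, baxba\<close>.\<close>

definition basis11 :: "generator list set" where
  "basis11 = {[GE1], [GA, GX, GB], [GA, GX, GX, GB], [GA, GX, GX, GB, GA, GX, GB]}"

definition basis12 :: "generator list set" where
  "basis12 = {[GA], [GA, GX], [GA, GX, GX], [GA, GX, GB, GA], [GA, GX, GX, GB, GA],
     [GA, GX, GX, GB, GA, GX]}"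

definition basis21 :: "generator list set" where
  "basis21 = {[GB], [GX, GB], [GX, GX, GB],
     [GB, GA, GX, GB], [GX, GB, GA, GX, GB], [GX, GX, GB, GA, GX, GB]}"

definition basis22 :: "generator list set" where
  "basis22 = {[GE2], [GX], [GX, GX],
     [GB, GA], [GX, GB, GA], [GX, GX, GB, GA],
     [GB, GA, GX], [GX, GB, GA, GX], [GX, GX, GB, GA, GX],
     [GB, GA, GX, GB, GA], [GX, GB, GA, GX, GB, GA], [GX, GX, GB, GA, GX, GB, GA]}"

definition basis :: "generator list set" where
  "basis = basis11 \<union> basis12 \<union> basis21 \<union> basis22"

lemmas basis_defs = basis_def basis11_def basis12_def basis21_def basis22_def

lemma finite_basis: "finite basis11" "finite basis12" "finite basis21" "finite basis22" "finite basis"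
  by (simp_all add: basis_defs)

section \<open>Identities in the algebra and the rewrite rules\<close>

lemma G2_path_append: "G2_path (us @ vs) = G2_path us * G2_path vs"
  by transfer (simp add: word_def mult_single plus_gword_def G2_cong_def two_sided_ideal.zero)

lemma G2_path_Nil: "G2_path [] = 1"
  by transfer (simp add: word_def G2_cong_def two_sided_ideal.zero flip: zero_gword_def)

lemma G2_path_Cons: "G2_path (g # h # gs) = G2_path [g] * G2_path (h # gs)"
  using G2_path_append[of "[g]" "h # gs"] by simp

abbreviation pa :: "'k::field Pi_G2" where "pa \<equiv> G2_path [GA]"
abbreviation pb :: "'k::field Pi_G2" where "pb \<equiv> G2_path [GB]"
abbreviation px :: "'k::field Pi_G2" where "px \<equiv> G2_path [GX]"

lemma relation_in_ideal: "r \<in> R \<Longrightarrow> r \<in> two_sided_ideal R"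
  using two_sided_ideal.gen[of r R 1 1] by simp

text \<open>Products are nested to the right, the shape that \<open>mult.assoc\<close> produces and
  that the rewrite rules below match.\<close>

lemma G2_relations_hold:
  "e1 * e1 = (e1 :: 'k::field Pi_G2)" "e2 * e2 = (e2 :: 'k Pi_G2)"
  "e1 * e2 = (0 :: 'k Pi_G2)" "e2 * e1 = (0 :: 'k Pi_G2)" "e1 + e2 = (1 :: 'k Pi_G2)"
  "e1 * (pa * e2) = (pa :: 'k Pi_G2)" "e2 * (pb * e1) = (pb :: 'k Pi_G2)"
  "e2 * (px * e2) = (px :: 'k Pi_G2)"
  "px * (px * px) = (0 :: 'k Pi_G2)" "pa * pb = (0 :: 'k Pi_G2)"
  "pb * (pa * (px * px)) + px * (pb * (pa * px)) + px * (px * (pb * pa)) = (0 :: 'k Pi_G2)"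
  by (transfer; simp add: G2_cong_def relation_in_ideal G2_relations_def word_def mult_single
      plus_gword_def)+

lemma corner_simps:
  fixes u :: "'a::{ring, semigroup_mult}"
  assumes "e * (u * f) = u" "e * e = e" "f * f = f" "e' * e = 0" "f * f' = 0"
  shows "e * u = u" "u * f = u" "e' * u = 0" "u * f' = 0"
proof -
  show eu: "e * u = u" and uf: "u * f = u"
    using assms(1-3) by (metis mult.assoc)+
  show "e' * u = 0" "u * f' = 0"
    using arg_cong[OF eu, of "\<lambda>z. e' * z"] arg_cong[OF uf, of "\<lambda>z. z * f'"] assms(4,5)
    by (metis mult.assoc mult_zero_left mult_zero_right)+
qed

lemmas vertex_simps [simp] = G2_relations_hold(1-4)
  corner_simps[OF G2_relations_hold(6,1,2,4,4)]
  corner_simps[OF G2_relations_hold(7,2,1,3,3)]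
  corner_simps[OF G2_relations_hold(8,2,2,3,4)]

lemma mult_eq_0_via_idempotent:
  fixes u v :: "'a::{ring, semigroup_mult}"
  assumes "u * f = u" "f * v = 0"
  shows "u * v = 0"
  using assms by (metis mult.assoc mult_zero_right)

text \<open>Besides \<open>ab = 0\<close> these are \<open>aa = bb = xa = bx = 0\<close>: such
  letters do not compose in the quiver.\<close>

lemmas junction_simps [simp] = G2_relations_hold(10)
  mult_eq_0_via_idempotent[OF vertex_simps(6,7)] mult_eq_0_via_idempotent[OF vertex_simps(10,11)]
  mult_eq_0_via_idempotent[OF vertex_simps(14,7)] mult_eq_0_via_idempotent[OF vertex_simps(10,15)]

text \<open>Inside a longer right-nested product, \<open>u * v\<close> occurs only as
  \<open>u * (v * z)\<close>, so each rule needs a companion with a tail \<open>z\<close>.\<close>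

lemma mult_assoc_rule:
  fixes u v w :: "'a::semigroup_mult"
  shows "u * v = w \<Longrightarrow> u * (v * z) = w * z"
  by (simp flip: mult.assoc)

lemmas left_simps [simp] = vertex_simps[THEN mult_assoc_rule] junction_simps[THEN mult_assoc_rule]

lemma xxx [simp]: "px * (px * px) = (0 :: 'k::field Pi_G2)"
  by (rule G2_relations_hold)

lemma xxx_left [simp]: "px * (px * (px * u)) = (0 :: 'k::field Pi_G2)"
  using arg_cong[OF xxx, of "\<lambda>z. z * u"] by (simp add: mult.assoc del: xxx)

lemma baxx [simp]:
  "pb * (pa * (px * px)) =
    - (px * (pb * (pa * px))) - px * (px * (pb * (pa :: 'k::field Pi_G2)))"
proof -
  have "pb * (pa * (px * px)) +
      (px * (pb * (pa * px)) + px * (px * (pb * (pa :: 'k Pi_G2)))) = 0"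
    using G2_relations_hold(11) by (simp only: add.assoc)
  then have "pb * (pa * (px * px)) =
      - (px * (pb * (pa * px)) + px * (px * (pb * (pa :: 'k Pi_G2))))"
    by (simp only: eq_neg_iff_add_eq_0)
  then show ?thesis by simp
qed

lemma baxx_left [simp]:
  "pb * (pa * (px * (px * u)))
    = - (px * (pb * (pa * (px * u)))) - px * (px * (pb * (pa * (u :: 'k::field Pi_G2))))"
  using arg_cong[OF baxx, of "\<lambda>z. z * u"] by (simp add: mult.assoc left_diff_distrib del: baxx)

text \<open>The word \<open>abaxx\<close> is reducible both by \<open>ab = 0\<close> and by
  \<open>baxx\<close>; comparing the results gives this rule.\<close>

lemma axbax [simp]:
  "pa * (px * (pb * (pa * px))) = - (pa * (px * (px * (pb * (pa :: 'k::field Pi_G2)))))"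
proof -
  have "- (pa * (px * (pb * (pa * px)))) = pa * (px * (px * (pb * (pa :: 'k Pi_G2))))"
    using arg_cong[OF baxx, of "\<lambda>z. pa * z"] by (simp add: right_diff_distrib del: baxx)
  then show ?thesis by (metis minus_minus)
qed

lemma axbax_left [simp]:
  "pa * (px * (pb * (pa * (px * u))))
    = - (pa * (px * (px * (pb * (pa * (u :: 'k::field Pi_G2))))))"
  using arg_cong[OF axbax, of "\<lambda>z. z * u"] by (simp add: mult.assoc del: axbax)

lemma axxbaxba [simp]:
  "pa * (px * (px * (pb * (pa * (px * (pb * pa)))))) = (0 :: 'k::field Pi_G2)"
proof -
  have "px * (px * (pb * pa))
      = - (pb * (pa * (px * px))) - px * (pb * (pa * (px :: 'k Pi_G2)))"
    by simp
  \<comment> \<open>Multiplying by \<open>axba\<close> kills the right-hand side and turns the left-hand side into \<open>- ax\<^sup>2baxba\<close>.\<close>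
  then have "pa * (px * (pb * (pa * (px * (px * (pb * pa))))))
      = pa * (px * (pb * (pa * (- (pb * (pa * (px * px))) - px * (pb * (pa * (px :: 'k Pi_G2)))))))"
    by (simp only:)
  \<comment> \<open>\<open>axbax_left\<close> reduces \<open>axbaxbax\<close> at its first
    \<open>axbax\<close>, which creates \<open>ab\<close>. The deleted \<open>axbax\<close> would
    act at the second one and lead back to \<open>axxbaxba\<close>; the deleted \<open>baxx\<close>
    would undo the substitution.\<close>
  also have "\<dots> = 0"
    by (simp add: right_diff_distrib del: baxx axbax)
  finally show ?thesis by simp
qed

section \<open>Reduction of every path to normal words\<close>

definition basis_deg :: "generator list set \<Rightarrow> nat \<Rightarrow> nat \<Rightarrow> generator list set" where
  "basis_deg K n d = {w \<in> K. path_length w = n \<and> x_degree w = d}"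

lemma normal_word_in_span:
  assumes "w \<in> basis"
  shows "(G2_path w :: 'k::field Pi_G2)
    \<in> Pi_G2.span (G2_path ` basis_deg basis (path_length w) (x_degree w))"
  using assms by (intro Pi_G2.span_base) (auto simp: basis_deg_def)

text \<open>A finite check: the rewrite rules turn each product of a normal word and a generator
  into 0 or a combination of normal words of the required bidegree.\<close>

lemma basis_mult_generator:
  assumes "w \<in> basis"
  shows "(G2_path w * G2_path [g] :: 'k::field Pi_G2)
    \<in> Pi_G2.span (G2_path ` basis_deg basis (path_length (w @ [g])) (x_degree (w @ [g])))"
proof -
  let ?S = "\<lambda>n d. Pi_G2.span (G2_path ` basis_deg basis n d :: 'k Pi_G2 set)"
  have "\<forall>w\<in>basis. G2_path w \<in> ?S (path_length w) (x_degree w)"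
    by (simp add: normal_word_in_span)
  \<comment> \<open>Only the range of the quantifier is unfolded; \<open>basis\<close> inside
    \<open>?S\<close> stays folded, so that these facts match the goals.\<close>
  then have *: "\<forall>w\<in>basis11 \<union> basis12 \<union> basis21 \<union> basis22. G2_path w \<in> ?S (path_length w) (x_degree w)"
    unfolding basis_def .
  have "\<forall>w\<in>basis11 \<union> basis12 \<union> basis21 \<union> basis22.
      G2_path w * G2_path [g] \<in> ?S (path_length (w @ [g])) (x_degree (w @ [g]))"
    using *
    by (cases g; simp add: basis11_def basis12_def basis21_def basis22_def path_length_def
        x_degree_def G2_path_Cons mult.assoc right_diff_distrib Pi_G2.span_zero Pi_G2.span_neg Pi_G2.span_diff)
  with assms show ?thesis unfolding basis_def by blast
qed

lemma path_length_append: "path_length (us @ vs) = path_length us + path_length vs"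
  by (simp add: path_length_def)

lemma x_degree_append: "x_degree (us @ vs) = x_degree us + x_degree vs"
  by (simp add: x_degree_def)

lemma module_hom_mult_right:
  "module_hom scale_Pi_G2 scale_Pi_G2 (\<lambda>u :: 'k::field Pi_G2. u * v)"
  by unfold_locales (simp_all add: distrib_right scale_Pi_G2_mult_left)

lemma module_hom_mult_left:
  "module_hom scale_Pi_G2 scale_Pi_G2 (\<lambda>u :: 'k::field Pi_G2. v * u)"
  by unfold_locales (simp_all add: distrib_left scale_Pi_G2_mult_right)

lemma path_in_span_basis:
  "(G2_path gs :: 'k::field Pi_G2)
    \<in> Pi_G2.span (G2_path ` basis_deg basis (path_length gs) (x_degree gs))"
proof (induction gs rule: rev_induct)
  case Nil
  \<comment> \<open>The empty word is not normal; its class is \<open>1 = e1 + e2\<close>.\<close>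
  have "[GE1] \<in> basis_deg basis 0 0" "[GE2] \<in> basis_deg basis 0 0"
    by (simp_all add: basis_deg_def basis_defs path_length_def x_degree_def)
  then have "e1 + e2 \<in> Pi_G2.span (G2_path ` basis_deg basis 0 0 :: 'k Pi_G2 set)"
    by (intro Pi_G2.span_add Pi_G2.span_base imageI)
  then show ?case
    by (simp add: G2_path_Nil path_length_def x_degree_def G2_relations_hold(5))
next
  case (snoc g gs)
  let ?B = "G2_path ` basis_deg basis (path_length gs) (x_degree gs) :: 'k Pi_G2 set"
  let ?f = "\<lambda>u :: 'k Pi_G2. u * G2_path [g]"
  have "?f (G2_path gs) \<in> ?f ` Pi_G2.span ?B"
    using snoc by (rule imageI)
  also have "?f ` Pi_G2.span ?B = Pi_G2.span (?f ` ?B)"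
    by (rule module_hom.span_image[OF module_hom_mult_right, symmetric])
  also have "\<dots> \<subseteq> Pi_G2.span (G2_path ` basis_deg basis (path_length (gs @ [g])) (x_degree (gs @ [g])))"
  proof (intro Pi_G2.span_minimal Pi_G2.subspace_span, clarify)
    fix w assume "w \<in> basis_deg basis (path_length gs) (x_degree gs)"
    then show "?f (G2_path w)
        \<in> Pi_G2.span (G2_path ` basis_deg basis (path_length (gs @ [g])) (x_degree (gs @ [g])))"
      using basis_mult_generator[of w g]
      by (simp add: basis_deg_def path_length_append x_degree_append)
  qed
  finally show ?case
    by (simp add: G2_path_append)
qed

section \<open>Spanning sets of the graded pieces and corners\<close>

lemma Pi_bideg_eq: "(Pi_bideg n d :: 'k::field Pi_G2 set) = Pi_G2.span (G2_path ` basis_deg basis n d)"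
  unfolding Pi_bideg_def Pi_G2.span_eq using path_in_span_basis
  by (force simp: basis_deg_def intro: Pi_G2.span_base)

lemma Pi_len_eq:
  "(Pi_len n :: 'k::field Pi_G2 set) = Pi_G2.span (G2_path ` {w \<in> basis. path_length w = n})"
  unfolding Pi_len_def Pi_G2.span_eq
proof (intro conjI subsetI)
  fix u :: "'k Pi_G2" assume "u \<in> {G2_path gs |gs. path_length gs = n}"
  then obtain gs where gs: "u = G2_path gs" "path_length gs = n" by blast
  have "basis_deg basis (path_length gs) (x_degree gs) \<subseteq> {w \<in> basis. path_length w = n}"
    using gs(2) by (auto simp: basis_deg_def)
  then show "u \<in> Pi_G2.span (G2_path ` {w \<in> basis. path_length w = n})"
    using path_in_span_basis[of gs] Pi_G2.span_mono[OF image_mono] unfolding gs(1) by blast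
qed (auto intro!: Pi_G2.span_base)

text \<open>The linear map sending \<open>u\<close> to \<open>e * u * f\<close> fixes the classes of
  words in \<open>K\<close> and kills those in \<open>L\<close>, so the image of a span of normal
  words is the span of those in \<open>K\<close>.\<close>

lemma corner_bideg_eq:
  fixes e f :: "'k::field Pi_G2"
  assumes "basis = K \<union> L"
    and "\<forall>w\<in>K. e * G2_path w * f = G2_path w"
    and "\<forall>w\<in>L. e * G2_path w * f = 0"
  shows "corner_bideg e f n d = Pi_G2.span (G2_path ` basis_deg K n d)"
proof -
  let ?f = "\<lambda>u. e * u * f"
  have "corner_bideg e f n d = ?f ` Pi_bideg n d"
    by (auto simp: corner_bideg_def)
  also have "\<dots> = Pi_G2.span (?f ` G2_path ` basis_deg basis n d)"
    unfolding Pi_bideg_eq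
    by (rule module_hom.span_image[symmetric])
      (rule module_hom_compose[OF module_hom_mult_left module_hom_mult_right, unfolded comp_def])
  also have "\<dots> = Pi_G2.span (G2_path ` basis_deg K n d)"
    unfolding Pi_G2.span_eq
  proof (intro conjI subsetI; clarify)
    fix w assume w: "w \<in> basis_deg basis n d"
    show "?f (G2_path w) \<in> Pi_G2.span (G2_path ` basis_deg K n d)"
    proof (cases "w \<in> K")
      case True
      with w show ?thesis by (auto simp: assms(2) basis_deg_def intro!: Pi_G2.span_base)
    next
      case False
      with w assms(1) have "w \<in> L"
        by (auto simp: basis_deg_def)
      with assms(3) show ?thesis
        by (simp add: Pi_G2.span_zero)
    qed
  next
    fix w assume "w \<in> basis_deg K n d"
    with assms(1,2) show "G2_path w \<in> Pi_G2.span (?f ` G2_path ` basis_deg basis n d)"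
      by (intro Pi_G2.span_base) (force simp: basis_deg_def image_iff)
  qed
  finally show ?thesis .
qed

lemma corner_bideg_basis:
  "corner_bideg e1 e1 n d = (Pi_G2.span (G2_path ` basis_deg basis11 n d) :: 'k::field Pi_G2 set)"
  "corner_bideg e1 e2 n d = (Pi_G2.span (G2_path ` basis_deg basis12 n d) :: 'k Pi_G2 set)"
  "corner_bideg e2 e1 n d = (Pi_G2.span (G2_path ` basis_deg basis21 n d) :: 'k Pi_G2 set)"
  "corner_bideg e2 e2 n d = (Pi_G2.span (G2_path ` basis_deg basis22 n d) :: 'k Pi_G2 set)"
proof -
  have
    "basis = basis11 \<union> (basis12 \<union> basis21 \<union> basis22)"
    "basis = basis12 \<union> (basis11 \<union> basis21 \<union> basis22)"
    "basis = basis21 \<union> (basis11 \<union> basis12 \<union> basis22)"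
    "basis = basis22 \<union> (basis11 \<union> basis12 \<union> basis21)"
    by (auto simp: basis_def)
  note eqs = this[THEN corner_bideg_eq]
  show
    "corner_bideg e1 e1 n d = (Pi_G2.span (G2_path ` basis_deg basis11 n d) :: 'k Pi_G2 set)"
    "corner_bideg e1 e2 n d = (Pi_G2.span (G2_path ` basis_deg basis12 n d) :: 'k Pi_G2 set)"
    "corner_bideg e2 e1 n d = (Pi_G2.span (G2_path ` basis_deg basis21 n d) :: 'k Pi_G2 set)"
    "corner_bideg e2 e2 n d = (Pi_G2.span (G2_path ` basis_deg basis22 n d) :: 'k Pi_G2 set)"
    by (rule eqs; simp add: basis_defs G2_path_Cons mult.assoc)+
qed

section \<open>Linear independence\<close>

text \<open>Coefficient functions are defined on all lists, not just on \<^const>\<open>basis\<close>. For \<open>e\<^sub>1 + e\<^sub>2 = 1\<close> to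
  hold on all of them, the junk positions are assigned to the vertex 2. The value \<open>right_act g v w\<close> is the
  coefficient of \<open>w\<close> in \<open>v \<cdot> g\<close>.\<close>

fun right_act :: "generator \<Rightarrow> (generator list \<Rightarrow> 'k::field) \<Rightarrow> generator list \<Rightarrow> 'k" where
  "right_act GE1 v w = (if w \<in> basis11 \<union> basis21 then v w else 0)"
| "right_act GE2 v w = (if w \<in> basis11 \<union> basis21 then 0 else v w)"
| "right_act GA v w =
    (if w = [GA] then v [GE1]
     else if w \<in> {[GB, GA], [GX, GB, GA], [GX, GX, GB, GA], [GA, GX, GB, GA], [GA, GX, GX, GB, GA],
       [GB, GA, GX, GB, GA], [GX, GB, GA, GX, GB, GA], [GX, GX, GB, GA, GX, GB, GA]}
       then v (butlast w)
     else 0)"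
| "right_act GB v w =
    (if w = [GB] then v [GE2]
     else if w \<in> basis11 \<union> basis21 - {[GE1]} then v (butlast w)
     else 0)"
| "right_act GX v w =
    (if w = [GX] then v [GE2]
     else if w \<in> {[GX, GX], [GA, GX], [GA, GX, GX], [GB, GA, GX], [GA, GX, GX, GB, GA, GX]}
       then v (butlast w)
     else if w = [GX, GB, GA, GX] then v [GX, GB, GA] - v [GB, GA, GX]
     else if w = [GX, GX, GB, GA, GX] then v [GX, GX, GB, GA] - v [GX, GB, GA, GX]
     else if w = [GX, GX, GB, GA] then - v [GB, GA, GX]
     else if w = [GA, GX, GX, GB, GA] then - v [GA, GX, GB, GA]
     else if w \<in> {[GX, GB, GA, GX, GB, GA], [GX, GX, GB, GA, GX, GB, GA]} then v (tl w)
     else 0)"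

lemma linear_endo_right_act: "linear_endo (right_act g)"
  by (cases g) (auto simp: linear_endo_def fun_eq_iff algebra_simps)

text \<open>The table is checked coefficient by coefficient. Its \<open>tl\<close> entries come from
  \<open>baxba * x = - baxxba = xbaxba\<close>, by \<open>axbax\<close> and \<open>baxx\<close>, and
  from the left multiple of this by \<open>x\<close>.\<close>

lemma right_act_relations:
  assumes "r \<in> G2_relations"
  shows "free_act right_act r v w = 0"
proof (cases "w \<in> basis")
  case True
  have "\<forall>w\<in>basis. free_act right_act r v w = 0"
    using assms unfolding G2_relations_def
    by (elim insertE emptyE; simp only: basis_defs ball_Un ball_simps; simp add: basis_defs)
  with True show ?thesis by blast
next
  case False
  \<comment> \<open>Outside \<open>basis\<close>, \<open>GE2\<close> acts as the identity and every
    other generator as 0.\<close>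
  then show ?thesis
    using assms unfolding G2_relations_def
    by (elim insertE emptyE; simp add: basis_defs)
qed

definition unit_vec :: "generator list \<Rightarrow> generator list \<Rightarrow> 'k::field" where
  "unit_vec u w = (if w = u then 1 else 0)"

lemma right_act_unit_vec:
  assumes "u \<in> basis" "u @ [g] \<in> basis"
  shows "right_act g (unit_vec u) = (unit_vec (u @ [g]) :: _ \<Rightarrow> 'k::field)"
proof
  fix w
  show "right_act g (unit_vec u) w = (unit_vec (u @ [g]) w :: 'k)"
  proof (cases "w \<in> basis")
    case True
    have "\<forall>u\<in>basis. u @ [g] \<in> basis \<longrightarrow>
        (\<forall>w\<in>basis. right_act g (unit_vec u) w = (unit_vec (u @ [g]) w :: 'k))"
      by (cases g; simp add: basis_defs unit_vec_def)
    with assms True show ?thesis by blast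
  next
    case False
    \<comment> \<open>A normal word ending in an idempotent is a single letter, while
      \<open>u\<close> is nonempty. The other generators give 0 outside
      \<open>basis\<close>.\<close>
    moreover have "g \<notin> {GE1, GE2}"
      using assms by (auto simp: basis_defs)
    moreover have "w \<noteq> u @ [g]"
      using False assms(2) by blast
    ultimately show ?thesis
      by (cases g; simp add: basis_defs unit_vec_def)
  qed
qed

abbreviation one_vec :: "generator list \<Rightarrow> 'k::field" where
  "one_vec \<equiv> (\<lambda>w. if w = [GE1] \<or> w = [GE2] then 1 else 0)"

lemma right_act_one_vec:
  "[g] \<in> basis \<Longrightarrow> right_act g one_vec = unit_vec [g]"
  by (cases g) (auto simp: basis_defs unit_vec_def fun_eq_iff)

lemma fold_right_act_basis:
  "u \<in> basis \<Longrightarrow> fold right_act u one_vec = unit_vec u"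
proof (induction u rule: rev_induct)
  case Nil
  then show ?case by (simp add: basis_defs)
next
  case (snoc g u)
  \<comment> \<open>\<open>basis\<close> is closed under nonempty prefixes, so a normal word is
    built letter by letter without leaving \<open>basis\<close>.\<close>
  have "\<forall>w\<in>basis. butlast w = [] \<or> butlast w \<in> basis"
    by (simp add: basis_defs)
  from bspec[OF this snoc.prems] consider "u = []" | "u \<in> basis"
    by auto
  then show ?case
    using snoc by cases (simp_all add: right_act_one_vec right_act_unit_vec del: right_act.simps)
qed

text \<open>An element is determined by its action on \<open>1 = e\<^sub>1 + e\<^sub>2\<close>.\<close>

lift_definition coord :: "'k::field Pi_G2 \<Rightarrow> generator list \<Rightarrow> 'k"
  is "\<lambda>p. free_act right_act p one_vec"
proof -
  fix p q :: "(generator, 'k) free_algebra" and v :: "generator list \<Rightarrow> 'k"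
  have relations: "free_act right_act r v = (\<lambda>w. 0)"
    if "r \<in> G2_relations" for r and v :: "generator list \<Rightarrow> 'k"
    using right_act_relations[OF that] by (rule ext)
  assume "G2_cong p q"
  then have "p - q \<in> two_sided_ideal G2_relations"
    by (simp add: G2_cong_def)
  with linear_endo_right_act relations have "free_act right_act (p - q) v = (\<lambda>w. 0)"
    by (rule free_act_ideal)
  then show "free_act right_act p v = free_act right_act q v"
    by (simp add: fun_eq_iff)
qed

lemma module_hom_coord: "module_hom scale_Pi_G2 (*) (\<lambda>u :: 'k::field Pi_G2. coord u w)"
proof
  fix u v :: "'k Pi_G2" and c :: 'k
  show "coord (u + v) w = coord u w + coord v w"
    by transfer simp
  show "coord (scale_Pi_G2 c u) w = c * coord u w"
  proof transfer
    fix c :: 'k and p and w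
    \<comment> \<open>\<open>scalar c\<close> is \<open>c\<close> times the empty word, so
      \<open>scalar c * p\<close> acts as \<open>p\<close> on a multiple of
      \<open>one_vec\<close>.\<close>
    have "free_act right_act (scalar c) one_vec = (\<lambda>w. c * one_vec w)"
      by (simp add: scalar_def zero_gword_def fun_eq_iff)
    then show "free_act right_act (scalar c * p) one_vec w = c * free_act right_act p one_vec w"
      by (simp only: free_act_mult[of right_act, OF linear_endo_right_act]
          linear_endo_scale[OF linear_endo_free_act[of right_act, OF linear_endo_right_act]])
  qed
qed (simp_all add: algebra_simps)

lemma coord_basis: "u \<in> basis \<Longrightarrow> coord (G2_path u) = unit_vec u"
  by transfer (simp add: fold_right_act_basis)

lemma inj_on_G2_path: "inj_on (G2_path :: _ \<Rightarrow> 'k::field Pi_G2) basis"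
  by (rule inj_onI) (metis coord_basis unit_vec_def zero_neq_one)

lemma independent_basis: "Pi_G2.independent (G2_path ` basis :: 'k::field Pi_G2 set)"
proof (rule Pi_G2.independent_if_scalars_zero)
  fix c :: "'k Pi_G2 \<Rightarrow> 'k" and u :: "'k Pi_G2"
  assume sum0: "(\<Sum>u\<in>G2_path ` basis. scale_Pi_G2 (c u) u) = 0" and "u \<in> G2_path ` basis"
  then obtain w where w: "w \<in> basis" "u = G2_path w" by blast
  interpret coord: module_hom scale_Pi_G2 "(*)" "\<lambda>u :: 'k Pi_G2. coord u w"
    by (rule module_hom_coord)
  have "0 = coord (\<Sum>w'\<in>basis. scale_Pi_G2 (c (G2_path w')) (G2_path w')) w"
    using sum0 by (simp add: sum.reindex[OF inj_on_G2_path] coord.zero)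
  also have "\<dots> = (\<Sum>w'\<in>basis. if w = w' then c (G2_path w') else 0)"
    by (auto simp: coord.sum coord.scale coord_basis unit_vec_def intro: sum.cong)
  also have "\<dots> = c u"
    using w by (simp add: finite_basis)
  finally show "c u = 0" by simp
qed (simp add: finite_basis)

lemma dim_span_basis:
  assumes "K \<subseteq> basis"
  shows "Pi_G2.dim (Pi_G2.span (G2_path ` K :: 'k::field Pi_G2 set)) = card K"
proof -
  have "Pi_G2.independent (G2_path ` K :: 'k Pi_G2 set)"
    using independent_basis image_mono[OF assms] by (rule Pi_G2.independent_mono)
  then have "Pi_G2.dim (Pi_G2.span (G2_path ` K :: 'k Pi_G2 set)) = card (G2_path ` K :: 'k Pi_G2 set)"
    by (rule Pi_G2.dim_span_eq_card_independent)
  also have "\<dots> = card K"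
    using inj_on_subset[OF inj_on_G2_path assms] by (rule card_image)
  finally show ?thesis .
qed

lemma Pi_fin_dim_span: "finite K \<Longrightarrow> Pi_fin_dim (Pi_G2.span (G2_path ` K :: 'k::field Pi_G2 set))"
  unfolding Pi_fin_dim_def by blast

section \<open>The series\<close>

text \<open>Turns counting into a sum of monomials, which can be evaluated directly for an explicit
  list of words.\<close>

lemma fps_card_eq_sum:
  assumes "finite K"
  shows "Abs_fps (\<lambda>n. int (card {w \<in> K. f w = n})) = (\<Sum>w\<in>K. fps_X ^ f w)"
proof (rule fps_ext)
  fix n
  have "int (card {w \<in> K. f w = n}) = (\<Sum>w\<in>K. if n = f w then 1 else 0)"
    using assms by (simp add: eq_commute flip: sum.inter_filter)
  then show "fps_nth (Abs_fps (\<lambda>n. int (card {w \<in> K. f w = n}))) n = fps_nth (\<Sum>w\<in>K. fps_X ^ f w) n"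
    by (simp add: fps_sum_nth fps_X_power_nth)
qed

text \<open>\<open>fps_const fps_X\<close> is \<open>s\<close>, a constant for the outer variable
  \<open>t\<close>; each coefficient in \<open>t\<close> falls under the one-variable case.\<close>

lemma fps_card2_eq_sum:
  assumes "finite K"
  shows "Abs_fps (\<lambda>n. Abs_fps (\<lambda>d. int (card {w \<in> K. f w = n \<and> g w = d})))
    = (\<Sum>w\<in>K. fps_X ^ f w * fps_const fps_X ^ g w)"
proof (rule fps_ext)
  fix n
  have "Abs_fps (\<lambda>d. int (card {w \<in> K. f w = n \<and> g w = d})) = (\<Sum>w\<in>{w \<in> K. f w = n}. fps_X ^ g w)"
    using fps_card_eq_sum[of "{w \<in> K. f w = n}" g] assms by (simp add: conj_assoc)
  also have "\<dots> = (\<Sum>w\<in>K. if n = f w then fps_X ^ g w else 0)"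
    using assms by (simp add: eq_commute flip: sum.inter_filter)
  also have "\<dots> = fps_nth (\<Sum>w\<in>K. fps_X ^ f w * fps_const fps_X ^ g w) n"
    unfolding fps_sum_nth
    by (intro sum.cong refl) (simp add: fps_const_power fps_X_power_nth)
  finally show "fps_nth (Abs_fps (\<lambda>n. Abs_fps (\<lambda>d. int (card {w \<in> K. f w = n \<and> g w = d})))) n
      = fps_nth (\<Sum>w\<in>K. fps_X ^ f w * fps_const fps_X ^ g w) n"
    by simp
qed

lemma hilbert_series_Pi_len:
  "hilbert_series (Pi_len :: nat \<Rightarrow> 'k::field Pi_G2 set) = (\<Sum>w\<in>basis. fps_X ^ path_length w)"
proof -
  have "{w \<in> basis. path_length w = n} \<subseteq> basis" for n by blast
  then show ?thesis
    unfolding hilbert_series_def Pi_len_eq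
    \<comment> \<open>\<open>Pi_G2.dim_span\<close> would remove the \<open>span\<close> on which
      \<open>dim_span_basis\<close> matches.\<close>
    by (simp add: dim_span_basis fps_card_eq_sum finite_basis del: Pi_G2.dim_span)
qed

lemma hilbert_series2_span_basis:
  assumes "K \<subseteq> basis"
  shows "hilbert_series2 (\<lambda>n d. Pi_G2.span (G2_path ` basis_deg K n d) :: 'k::field Pi_G2 set)
    = (\<Sum>w\<in>K. fps_X ^ path_length w * fps_const fps_X ^ x_degree w)"
proof -
  have "basis_deg K n d \<subseteq> basis" for n d
    using assms by (auto simp: basis_deg_def)
  moreover have "finite K"
    using assms finite_basis(5) by (rule finite_subset)
  ultimately show ?thesis
    unfolding hilbert_series2_def hilbert_series_def
    \<comment> \<open>\<open>basis_deg\<close> is unfolded only in the second call, since the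
      inclusion in \<open>basis\<close> is stated for its folded form.\<close>
    by (simp add: dim_span_basis del: Pi_G2.dim_span) (simp add: basis_deg_def fps_card2_eq_sum)
qed

theorem corollary5p6:
  fixes h :: "'k::field Pi_G2 \<Rightarrow> 'k Pi_G2 \<Rightarrow> int fps fps"
    and t s :: "int fps fps"
  defines "h \<equiv> \<lambda>e f. hilbert_series2 (corner_bideg e f)"
    and "t \<equiv> fps_X"
    and "s \<equiv> fps_const fps_X"
  shows "(\<forall>n. Pi_fin_dim (Pi_len n :: 'k Pi_G2 set))
    \<and> hilbert_series (Pi_len :: nat \<Rightarrow> 'k Pi_G2 set)
        = 4 + 6 * fps_X + 8 * fps_X ^ 2 + 6 * fps_X ^ 3 + 4 * fps_X ^ 4
    \<and> (\<forall>n d. \<forall>e \<in> {e1, e2}. \<forall>f \<in> {e1, e2}.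
         Pi_fin_dim (corner_bideg e f n d :: 'k Pi_G2 set))
    \<and> mat_of_rows_list 2
         [[h e1 e1, h e1 e2],
          [h e2 e1, h e2 e2]]
        = (1 + t ^ 2 * s) \<cdot>\<^sub>m mat_of_rows_list 2
         [[1 + t ^ 2 * s ^ 2, (1 + s + s ^ 2) * t],
          [(1 + s + s ^ 2) * t, (1 + s + s ^ 2) * (1 + t ^ 2)]]"
proof (intro conjI allI ballI)
  show "Pi_fin_dim (Pi_len n :: 'k Pi_G2 set)" for n
    unfolding Pi_len_eq by (intro Pi_fin_dim_span) (simp add: finite_basis)
  show "hilbert_series (Pi_len :: nat \<Rightarrow> 'k Pi_G2 set)
      = 4 + 6 * fps_X + 8 * fps_X ^ 2 + 6 * fps_X ^ 3 + 4 * fps_X ^ 4"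
    unfolding hilbert_series_Pi_len
    by (simp add: basis_defs path_length_def numeral_eq_Suc)
  have fin: "finite (basis_deg K n d)" if "finite K" for K n d
    using that by (simp add: basis_deg_def)
  show "Pi_fin_dim (corner_bideg e f n d :: 'k Pi_G2 set)" if "e \<in> {e1, e2}" "f \<in> {e1, e2}" for n d e f
    using that by (elim insertE emptyE) (simp_all add: corner_bideg_basis Pi_fin_dim_span fin finite_basis)
  have sub: "basis11 \<subseteq> basis" "basis12 \<subseteq> basis" "basis21 \<subseteq> basis" "basis22 \<subseteq> basis"
    by (auto simp: basis_def)
  \<comment> \<open>Each sum over a list factors; for \<open>basis11\<close> it is
    \<open>1 + t^2 s + t^2 s^2 + t^4 s^3\<close>.\<close>
  have "h e1 e1 = (1 + t ^ 2 * s) * (1 + t ^ 2 * s ^ 2)"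
    "h e1 e2 = (1 + t ^ 2 * s) * ((1 + s + s ^ 2) * t)"
    "h e2 e1 = (1 + t ^ 2 * s) * ((1 + s + s ^ 2) * t)"
    "h e2 e2 = (1 + t ^ 2 * s) * ((1 + s + s ^ 2) * (1 + t ^ 2))"
    unfolding h_def corner_bideg_basis hilbert_series2_span_basis[OF sub(1)]
      hilbert_series2_span_basis[OF sub(2)] hilbert_series2_span_basis[OF sub(3)]
      hilbert_series2_span_basis[OF sub(4)] t_def[symmetric] s_def[symmetric]
    by (simp_all add: basis11_def basis12_def basis21_def basis22_def path_length_def x_degree_def
        numeral_eq_Suc algebra_simps)
  then show "mat_of_rows_list 2
         [[h e1 e1, h e1 e2],
          [h e2 e1, h e2 e2]]
        = (1 + t ^ 2 * s) \<cdot>\<^sub>m mat_of_rows_list 2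
         [[1 + t ^ 2 * s ^ 2, (1 + s + s ^ 2) * t],
          [(1 + s + s ^ 2) * t, (1 + s + s ^ 2) * (1 + t ^ 2)]]"
    by (intro eq_matI) (auto simp: mat_of_rows_list_def less_Suc_eq less_2_cases_iff)
qed

end
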